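(* Let $$A=\begin{bmatrix}0&1&0&0&0&0\\0&0&1&0&0&0\\0&0&0&0&0&0\\0&0&0&0&1&0\\0&0&0&0&0&0\\0&0&0&0&0&0\end{bmatrix}\in M_6(\mathbb{F}).$$ Then $A$ is a 3-regular nilpotent matrix and the variety $N_2(A)$ is reducible.
   Context: $\mathbb{F}$ is an algebraically closed field of arbitrary characteristic. A matrix in $M_n(\mathbb{F})$ is called $r$-regular if each of its eigenspaces is at most $r$-dimensional. For a nilpotent $A\in M_n(\mathbb{F})$, $N_2(A)=\{(B,C)\in M_n(\mathbb{F})^2 : B, C \text{ nilpotent},\ AB=BA,\ AC=CA,\ BC=CB\}$, a Zariski closed subset of the affine space $M_n(\mathbb{F})^2$. Reducible means not irreducible in the Zariski topology. *)

theory Defs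
  imports "HOL-Analysis.Analysis"
begin

(* Powers are taken with respect to the matrix product: the library's "*" on "'a ^ 'n ^ 'n" is
   componentwise, so "A ^ k" would not be the matrix power. *)
definition nilpotent_matrix :: "'a::field ^ 'n ^ 'n \<Rightarrow> bool" where
  "nilpotent_matrix A \<longleftrightarrow> (\<exists>k. (((**) A) ^^ k) (mat 1) = 0)"

definition eigenspace :: "'a::field ^ 'n ^ 'n \<Rightarrow> 'a \<Rightarrow> ('a ^ 'n) set" where
  "eigenspace A c = {v. A *v v = c *s v}"

(* If c is not an eigenvalue of A, then "eigenspace A c" is zero and imposes no condition. *)
definition regular_matrix :: "nat \<Rightarrow> 'a::field ^ 'n ^ 'n \<Rightarrow> bool" where
  "regular_matrix r A \<longleftrightarrow> (\<forall>c. vec.dim (eigenspace A c) \<le> r)"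

definition N2 :: "'a::field ^ 'n ^ 'n \<Rightarrow> (('a ^ 'n ^ 'n) \<times> ('a ^ 'n ^ 'n)) set" where
  "N2 A = {(B, C). nilpotent_matrix B \<and> nilpotent_matrix C \<and>
     A ** B = B ** A \<and> A ** C = C ** A \<and> B ** C = C ** B}"

(* Polynomial functions in the matrix entries on the affine space of pairs of matrices. *)
inductive entry_polynomial ::
    "(('a::field ^ 'n ^ 'n) \<times> ('a ^ 'n ^ 'n) \<Rightarrow> 'a) \<Rightarrow> bool" where
  const: "entry_polynomial (\<lambda>X. c)"
| entry_fst: "entry_polynomial (\<lambda>X. fst X $ i $ j)"
| entry_snd: "entry_polynomial (\<lambda>X. snd X $ i $ j)"
| add: "entry_polynomial p \<Longrightarrow> entry_polynomial q \<Longrightarrow> entry_polynomial (\<lambda>X. p X + q X)"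
| mult: "entry_polynomial p \<Longrightarrow> entry_polynomial q \<Longrightarrow> entry_polynomial (\<lambda>X. p X * q X)"

definition zariski_closed :: "(('a::field ^ 'n ^ 'n) \<times> ('a ^ 'n ^ 'n)) set \<Rightarrow> bool" where
  "zariski_closed S \<longleftrightarrow> (\<exists>P. (\<forall>p\<in>P. entry_polynomial p) \<and> S = {X. \<forall>p\<in>P. p X = 0})"

definition zariski_topology :: "(('a::field ^ 'n ^ 'n) \<times> ('a ^ 'n ^ 'n)) topology" where
  "zariski_topology = topology (\<lambda>U. zariski_closed (- U))"

definition irreducible_space :: "'b topology \<Rightarrow> bool" where
  "irreducible_space X \<longleftrightarrow> topspace X \<noteq> {} \<and>
     (\<forall>S T. closedin X S \<and> closedin X T \<and> S \<union> T = topspace X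
        \<longrightarrow> S = topspace X \<or> T = topspace X)"

definition zariski_reducible :: "(('a::field ^ 'n ^ 'n) \<times> ('a ^ 'n ^ 'n)) set \<Rightarrow> bool" where
  "zariski_reducible V \<longleftrightarrow> \<not> irreducible_space (subtopology zariski_topology V)"

lemma zariski_closed_UNIV: "zariski_closed UNIV"
  unfolding zariski_closed_def by (rule exI[of _ "{}"]) auto

lemma zariski_closed_empty: "zariski_closed {}"
  unfolding zariski_closed_def
  by (rule exI[of _ "{\<lambda>X. 1}"]) (auto intro: entry_polynomial.const)

lemma zariski_closed_Un:
  assumes "zariski_closed S" "zariski_closed T"
  shows "zariski_closed (S \<union> T)"
proof -
  obtain P where P: "\<forall>p\<in>P. entry_polynomial p" "S = {X. \<forall>p\<in>P. p X = 0}"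
    using assms(1) unfolding zariski_closed_def by blast
  obtain Q where Q: "\<forall>q\<in>Q. entry_polynomial q" "T = {X. \<forall>q\<in>Q. q X = 0}"
    using assms(2) unfolding zariski_closed_def by blast
  let ?R = "{\<lambda>X. p X * q X |p q. p \<in> P \<and> q \<in> Q}"
  have "\<forall>r\<in>?R. entry_polynomial r"
    using P(1) Q(1) by (auto intro: entry_polynomial.mult)
  moreover have "S \<union> T = {X. \<forall>r\<in>?R. r X = 0}"
  proof (intro set_eqI iffI)
    fix X assume "X \<in> S \<union> T"
    then show "X \<in> {X. \<forall>r\<in>?R. r X = 0}" unfolding P(2) Q(2) by auto
  next
    fix X assume X: "X \<in> {X. \<forall>r\<in>?R. r X = 0}"
    have "p X * q X = 0" if "p \<in> P" "q \<in> Q" for p q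
    proof -
      have "(\<lambda>X. p X * q X) \<in> ?R" using that by blast
      then show ?thesis by (rule bspec[OF CollectD[OF X]])
    qed
    then show "X \<in> S \<union> T" unfolding P(2) Q(2) by auto
  qed
  ultimately show ?thesis unfolding zariski_closed_def by blast
qed

lemma zariski_closed_Inter:
  assumes "\<forall>S\<in>K. zariski_closed S"
  shows "zariski_closed (\<Inter>K)"
proof -
  have ex: "\<forall>S\<in>K. \<exists>P. (\<forall>p\<in>P. entry_polynomial p) \<and> (\<forall>X. X \<in> S \<longleftrightarrow> (\<forall>p\<in>P. p X = 0))"
    using assms unfolding zariski_closed_def by fast
  obtain P where P: "\<forall>S\<in>K. (\<forall>p\<in>P S. entry_polynomial p) \<and>
      (\<forall>X. X \<in> S \<longleftrightarrow> (\<forall>p\<in>P S. p X = 0))"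
    using bchoice[OF ex] by (elim exE)
  have "\<Inter>K = {X. \<forall>p\<in>(\<Union>S\<in>K. P S). p X = 0}"
  proof (intro set_eqI)
    fix X show "X \<in> \<Inter>K \<longleftrightarrow> X \<in> {X. \<forall>p\<in>(\<Union>S\<in>K. P S). p X = 0}"
      using bspec[OF P] by (auto simp del: split_paired_All)
  qed
  moreover have "\<forall>p\<in>(\<Union>S\<in>K. P S). entry_polynomial p"
    using P by simp
  ultimately show ?thesis unfolding zariski_closed_def by blast
qed

lemma istopology_zariski: "istopology (\<lambda>U. zariski_closed (- U))"
  unfolding istopology_def
proof (intro conjI allI impI)
  fix S T :: "(('a ^ 'n ^ 'n) \<times> ('a ^ 'n ^ 'n)) set"
  assume "zariski_closed (- S)" "zariski_closed (- T)"
  then show "zariski_closed (- (S \<inter> T))"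
    by (simp add: zariski_closed_Un)
next
  fix K :: "(('a ^ 'n ^ 'n) \<times> ('a ^ 'n ^ 'n)) set set"
  assume "\<forall>S\<in>K. zariski_closed (- S)"
  then have "zariski_closed (\<Inter>(uminus ` K))"
    by (intro zariski_closed_Inter) auto
  then show "zariski_closed (- \<Union>K)"
    by (simp add: uminus_Sup)
qed

lemma openin_zariski: "openin zariski_topology U \<longleftrightarrow> zariski_closed (- U)"
  unfolding zariski_topology_def by (simp add: topology_inverse' istopology_zariski)

lemma topspace_zariski [simp]: "topspace zariski_topology = UNIV"
  using openin_subset[of zariski_topology UNIV] zariski_closed_empty
  by (auto simp: openin_zariski)

lemma closedin_zariski: "closedin zariski_topology S \<longleftrightarrow> zariski_closed S"
  by (simp add: closedin_def openin_zariski Compl_eq_Diff_UNIV[symmetric])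

(* In the index type 6 the numeral 6 denotes 0, so the indices 1, ..., 6 are all distinct. *)
lemma vector_6:
  "(vector [a, b, c, d, e, f] :: 'a::zero ^ 6) $ 1 = a"
  "(vector [a, b, c, d, e, f] :: 'a::zero ^ 6) $ 2 = b"
  "(vector [a, b, c, d, e, f] :: 'a::zero ^ 6) $ 3 = c"
  "(vector [a, b, c, d, e, f] :: 'a::zero ^ 6) $ 4 = d"
  "(vector [a, b, c, d, e, f] :: 'a::zero ^ 6) $ 5 = e"
  "(vector [a, b, c, d, e, f] :: 'a::zero ^ 6) $ 6 = f"
  unfolding vector_def by simp_all

end

theory Submission
  imports Defs
begin

text \<open>
  View a pair in \<open>N2 A\<close> as two commuting nilpotent endomorphisms of the module
  \<open>F[x]/x^3 \<oplus> F[x]/x^2 \<oplus> F[x]/x\<close>, on which \<open>x\<close> acts as \<open>A\<close>. Write \<open>b, d, f, h\<close> for the leading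
  coefficients of the components from the second summand to the first, the first to the second,
  the third to the second and the second to the third. Commutation forces
  \<open>b D = B d\<close> and \<open>b F = B f\<close> (capitals for the second endomorphism). If \<open>d F \<noteq> D f\<close>, then
  \<open>b = B = 0\<close>. Hence \<open>(d F - D f) (b H - B h)\<close> vanishes on \<open>N2 A\<close>, and neither factor does.
\<close>

lemma exhaust_6:
  fixes x :: 6
  shows "x = 1 \<or> x = 2 \<or> x = 3 \<or> x = 4 \<or> x = 5 \<or> x = 6"
proof (induct x)
  case (of_int z)
  then have "0 \<le> z" and "z < 6" by simp_all
  then have "z = 0 \<or> z = 1 \<or> z = 2 \<or> z = 3 \<or> z = 4 \<or> z = 5" by arith
  \<comment> \<open>The case \<open>z = 0\<close> is the index 6.\<close>
  then show ?case by auto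
qed

lemma forall_6: "(\<forall>i::6. P i) \<longleftrightarrow> P 1 \<and> P 2 \<and> P 3 \<and> P 4 \<and> P 5 \<and> P 6"
  by (metis exhaust_6)

lemma UNIV_6: "(UNIV :: 6 set) = {1, 2, 3, 4, 5, 6}"
  using exhaust_6 by auto

lemma sum_6: "sum f (UNIV :: 6 set) = f 1 + f 2 + f 3 + f 4 + f 5 + f 6"
  unfolding UNIV_6 by (simp add: add.assoc)

lemma entry_polynomial_diff:
  assumes "entry_polynomial p" "entry_polynomial q"
  shows "entry_polynomial (\<lambda>X. p X - q X)"
  using entry_polynomial.add[OF assms(1) entry_polynomial.mult[OF entry_polynomial.const[of "-1"] assms(2)]]
  by simp

text \<open>The zero loci of \<open>p\<close> and \<open>q\<close> cut out two relatively closed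
  subsets covering \<open>V\<close>; \<open>Y\<close> and \<open>Z\<close> show that each is
  proper.\<close>

lemma zariski_reducibleI:
  assumes p: "entry_polynomial p" and q: "entry_polynomial q"
    and pq: "\<And>X. X \<in> V \<Longrightarrow> p X = 0 \<or> q X = 0"
    and Y: "Y \<in> V" "p Y \<noteq> 0" and Z: "Z \<in> V" "q Z \<noteq> 0"
  shows "zariski_reducible V"
proof -
  have cl: "closedin (subtopology zariski_topology V) ({X. r X = 0} \<inter> V)"
    if "entry_polynomial r" for r
  proof -
    have "zariski_closed {X. r X = 0}"
      unfolding zariski_closed_def by (rule exI[of _ "{r}"]) (simp add: that)
    then show ?thesis
      by (auto simp: closedin_subtopology closedin_zariski)
  qed
  show ?thesis
    unfolding zariski_reducible_def irreducible_space_def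
  proof (intro notI, elim conjE)
    assume "\<forall>S T. closedin (subtopology zariski_topology V) S \<and>
      closedin (subtopology zariski_topology V) T \<and> S \<union> T = topspace (subtopology zariski_topology V)
      \<longrightarrow> S = topspace (subtopology zariski_topology V) \<or> T = topspace (subtopology zariski_topology V)"
    moreover have "({X. p X = 0} \<inter> V) \<union> ({X. q X = 0} \<inter> V) = V"
      using pq by blast
    ultimately have "{X. p X = 0} \<inter> V = V \<or> {X. q X = 0} \<inter> V = V"
      using cl[OF p] cl[OF q] by simp
    then show False
      using Y Z by blast
  qed
qed

text \<open>Each application of \<open>B\<close> stays in \<open>W\<close> and scales the
  \<open>i\<close>-th coordinate by \<open>c\<close>, so a vanishing power of \<open>B\<close>
  forces a vanishing power of \<open>c\<close>.\<close>

lemma nilpotent_eigenvalue_zero: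
  fixes B :: "'a::field ^ 'n ^ 'n"
  assumes "nilpotent_matrix B"
    and W: "\<And>w. w \<in> W \<Longrightarrow> B *v w \<in> W \<and> (B *v w) $ i = c * w $ i"
    and w: "w \<in> W" "w $ i \<noteq> 0"
  shows "c = 0"
proof -
  obtain k where k: "(((**) B) ^^ k) (mat 1) = 0"
    using assms(1) unfolding nilpotent_matrix_def by blast
  have "((((**) B) ^^ m) (mat 1)) *v w \<in> W \<and>
      (((((**) B) ^^ m) (mat 1)) *v w) $ i = c ^ m * w $ i" for m
    by (induction m) (auto simp: w W matrix_vector_mul_assoc[symmetric])
  from this[of k] have "c ^ k = 0"
    using w(2) by (simp add: k)
  then show ?thesis by simp
qed

lemma nilpotent_matrixI_square_zero:
  assumes "B ** B = 0"
  shows "nilpotent_matrix B"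
  unfolding nilpotent_matrix_def
  by (rule exI[of _ 2]) (simp add: numeral_2_eq_2 assms)

text \<open>The Jordan blocks have sizes 3, 2, 1; the basis vectors 3, 5, 6 generate the three
  cyclic summands.\<close>

definition nilp321 :: "'a::field ^ 6 ^ 6" where
  "nilp321 = vector
    [vector [0, 1, 0, 0, 0, 0],
     vector [0, 0, 1, 0, 0, 0],
     vector [0, 0, 0, 0, 0, 0],
     vector [0, 0, 0, 0, 1, 0],
     vector [0, 0, 0, 0, 0, 0],
     vector [0, 0, 0, 0, 0, 0]]"

lemmas mat6_simps = vec_eq_iff matrix_matrix_mult_def matrix_vector_mult_def forall_6 sum_6

lemma regular_nilp321: "regular_matrix 3 nilp321"
  unfolding regular_matrix_def
proof
  fix c :: 'a
  let ?E = "{axis 1 1, axis 4 1, axis 6 1} :: ('a ^ 6) set"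
  have "v \<in> vec.span ?E" if "v \<in> eigenspace nilp321 c" for v
  proof -
    \<comment> \<open>These equations describe the kernel, which is the eigenspace for
      \<open>c = 0\<close>; for \<open>c \<noteq> 0\<close> the eigenspace is zero.\<close>
    have "v $ 2 = 0 \<and> v $ 3 = 0 \<and> v $ 5 = 0"
      using that by (auto simp: eigenspace_def nilp321_def vector_6 mat6_simps)
    then have "v = v $ 1 *s axis 1 1 + v $ 4 *s axis 4 1 + v $ 6 *s axis 6 1"
      by (simp add: vec_eq_iff forall_6 axis_def)
    moreover have "\<dots> \<in> vec.span ?E"
      by (intro vec.span_add vec.span_scale vec.span_base) auto
    ultimately show ?thesis by simp
  qed
  then have "vec.dim (eigenspace nilp321 c) \<le> card ?E"
    by (intro vec.dim_le_card) auto
  also have "\<dots> \<le> 3"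
    by (simp add: card_insert_if)
  finally show "vec.dim (eigenspace nilp321 c) \<le> 3" .
qed

lemma nilpotent_nilp321: "nilpotent_matrix nilp321"
  unfolding nilpotent_matrix_def
  by (rule exI[of _ 3]) (simp add: numeral_3_eq_3 nilp321_def vector_6 mat6_simps mat_def)

text \<open>With A = \<open>nilp321\<close>, the map \<open>B\<close> preserves the image of A^2
  (column 1), the intersection of image and kernel of A (column 4) and the kernel of A (column 6).
  The equalities compare coefficients in B A v = A B v for basis vectors v.\<close>

lemma commute_nilp321:
  assumes "nilp321 ** B = B ** nilp321"
  shows "B $ 2 $ 1 = 0" "B $ 3 $ 1 = 0" "B $ 4 $ 1 = 0" "B $ 5 $ 1 = 0" "B $ 6 $ 1 = 0"
    "B $ 2 $ 4 = 0" "B $ 3 $ 4 = 0" "B $ 5 $ 4 = 0" "B $ 6 $ 4 = 0"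
    "B $ 2 $ 6 = 0" "B $ 3 $ 6 = 0" "B $ 5 $ 6 = 0"
    "B $ 2 $ 2 = B $ 1 $ 1" "B $ 3 $ 3 = B $ 1 $ 1" "B $ 1 $ 4 = B $ 2 $ 5"
  using assms by (auto simp: nilp321_def vector_6 mat6_simps)

lemma nilpotent_commute_nilp321:
  assumes B: "nilpotent_matrix B" and AB: "nilp321 ** B = B ** nilp321"
  shows "B $ 1 $ 1 = 0" "B $ 6 $ 6 = 0"
proof -
  note z = commute_nilp321[OF AB]
  \<comment> \<open>Both sets \<open>W\<close> are stable under the commutant of
    \<open>nilp321\<close>: first the image of its square, then its kernel.\<close>
  show "B $ 1 $ 1 = 0"
    by (rule nilpotent_eigenvalue_zero[OF B, where i = 1 and w = "axis 1 1"
          and W = "{w. w $ 2 = 0 \<and> w $ 3 = 0 \<and> w $ 4 = 0 \<and> w $ 5 = 0 \<and> w $ 6 = 0}"])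
       (auto simp: z mat6_simps axis_def)
  show "B $ 6 $ 6 = 0"
    by (rule nilpotent_eigenvalue_zero[OF B, where i = 6 and w = "axis 6 1"
          and W = "{w. w $ 2 = 0 \<and> w $ 3 = 0 \<and> w $ 5 = 0}"])
       (auto simp: z mat6_simps axis_def)
qed

lemma commuting_relations_nilp321:
  assumes "(B, C) \<in> N2 nilp321"
  shows "B $ 2 $ 5 * C $ 5 $ 3 = C $ 2 $ 5 * B $ 5 $ 3"
    and "B $ 2 $ 5 * C $ 4 $ 6 = C $ 2 $ 5 * B $ 4 $ 6"
proof -
  from assms have B: "nilpotent_matrix B" "nilp321 ** B = B ** nilp321"
    and C: "nilpotent_matrix C" "nilp321 ** C = C ** nilp321" and BC: "B ** C = C ** B"
    by (auto simp: N2_def)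
  note z = commute_nilp321[OF B(2)] commute_nilp321[OF C(2)]
    nilpotent_commute_nilp321[OF B] nilpotent_commute_nilp321[OF C]
  \<comment> \<open>At these entries the known zeros leave a single product on each side; the second
    uses \<open>B $ 1 $ 4 = B $ 2 $ 5\<close> and its analogue for \<open>C\<close>.\<close>
  have "(B ** C) $ 2 $ 3 = (C ** B) $ 2 $ 3" "(B ** C) $ 1 $ 6 = (C ** B) $ 1 $ 6"
    using BC by simp_all
  then show "B $ 2 $ 5 * C $ 5 $ 3 = C $ 2 $ 5 * B $ 5 $ 3"
    and "B $ 2 $ 5 * C $ 4 $ 6 = C $ 2 $ 5 * B $ 4 $ 6"
    by (simp_all add: matrix_matrix_mult_def sum_6 z)
qed

lemma zariski_reducible_N2_nilp321: "zariski_reducible (N2 (nilp321 :: 'a::field ^ 6 ^ 6))"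
proof -
  let ?p = "\<lambda>X :: ('a ^ 6 ^ 6) \<times> ('a ^ 6 ^ 6).
    fst X $ 5 $ 3 * snd X $ 4 $ 6 - snd X $ 5 $ 3 * fst X $ 4 $ 6"
  let ?q = "\<lambda>X :: ('a ^ 6 ^ 6) \<times> ('a ^ 6 ^ 6).
    fst X $ 2 $ 5 * snd X $ 6 $ 5 - snd X $ 2 $ 5 * fst X $ 6 $ 5"
  let ?E = "\<lambda>S. (\<chi> i j. if (i, j) \<in> S then 1 else 0) :: 'a ^ 6 ^ 6"
  \<comment> \<open>\<open>?Y\<close> has d = F = 1 and \<open>?Z\<close> has b = H = 1, the other
    leading coefficients being 0. Commutation with \<open>nilp321\<close> forces the extra entries
    (4, 2) and (1, 4).\<close>
  let ?Y = "(?E {(5, 3), (4, 2)}, ?E {(4, 6)})"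
  let ?Z = "(?E {(2, 5), (1, 4)}, ?E {(6, 5)})"
  show ?thesis
  proof (rule zariski_reducibleI[where p = ?p and q = ?q and Y = ?Y and Z = ?Z])
    show "entry_polynomial ?p" "entry_polynomial ?q"
      by (intro entry_polynomial_diff entry_polynomial.intros)+
    show "?p X = 0 \<or> ?q X = 0" if "X \<in> N2 nilp321" for X
    proof -
      obtain B C where X: "X = (B, C)" by (cases X)
      note r = commuting_relations_nilp321[OF that[unfolded X]]
      \<comment> \<open>The relations make (d, D) and (f, F) both proportional to (b, B) unless b =
        B = 0; \<open>?p\<close> is their determinant, and b = B = 0 makes \<open>?q\<close>
        vanish.\<close>
      have "B $ 2 $ 5 * ?p X = 0" "C $ 2 $ 5 * ?p X = 0"
        using r unfolding X fst_conv snd_conv by algebra+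
      then show ?thesis
        by (auto simp: X)
    qed
    show "?Y \<in> N2 nilp321" "?Z \<in> N2 nilp321"
      by (auto simp: N2_def nilp321_def vector_6 mat6_simps intro!: nilpotent_matrixI_square_zero)
    show "?p ?Y \<noteq> 0" "?q ?Z \<noteq> 0"
      by simp_all
  qed
qed

theorem proposition19:
  fixes A :: "'a::alg_closed_field ^ 6 ^ 6"
  assumes "A = vector
    [vector [0, 1, 0, 0, 0, 0],
     vector [0, 0, 1, 0, 0, 0],
     vector [0, 0, 0, 0, 0, 0],
     vector [0, 0, 0, 0, 1, 0],
     vector [0, 0, 0, 0, 0, 0],
     vector [0, 0, 0, 0, 0, 0]]"
  shows "regular_matrix 3 A \<and> nilpotent_matrix A \<and> zariski_reducible (N2 A)"
  using regular_nilp321 nilpotent_nilp321 zariski_reducible_N2_nilp321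
  unfolding assms nilp321_def by blast

end
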